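(* For $n\ge 1$, $$G_n(q) = \sum_{i=0}^{n-1}\binom{n-1}{i}\, q^{\ln(i+1)}\, G_i(q)\, G_{n-1-i}(q).$$
   Context: Write $[n]=\{1,\dots,n\}$. A street has parking spots $1,\dots,n$ in order, and cars $c_1,\dots,c_n$ arrive in this order. Given $\alpha=(a_1,\dots,a_n)\in[n]^n$, car $c_i$ drives to its preferred spot $a_i$ and parks there if it is empty; otherwise it continues forward and parks in the first empty spot after $a_i$, if there is one (otherwise it fails to park). The tuple $\alpha$ is a parking function of length $n$ if all $n$ cars park; $PF_n$ is the set of parking functions of length $n$. The map $\varphi:PF_n\to S_n$ sends $\alpha$ to the permutation $s_1s_2\cdots s_n$ (one-line notation), where spot $i$ is occupied by car $c_{s_i}$ after all cars have parked. For $n\ge 0$, $c_{n,i}$ is the number of permutations $\sigma\in S_n$ with $|\varphi^{-1}(\sigma)|=i$; for $n=0$ there is one (empty) permutation and one (empty) parking function, so $c_{0,1}=1$ and $c_{0,i}=0$ for $i\ne1$. The logarithmic generating function is $$G_n(q)=\sum_{i=1}^{n!} c_{n,i}\, q^{\ln i},$$ with $\ln$ the natural logarithm; in particular $G_0(q)=1$. Here $q$ is a formal variable with real exponents, $q^{r}q^{s}=q^{r+s}$ and $q^0=1$. *)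

theory Defs
  imports
    Complex_Main
    "HOL-Library.FuncSet"
    "HOL-Library.Poly_Mapping"
    "HOL-Combinatorics.Permutations"
begin

text \<open>
  A street configuration is a partial map sending each occupied spot to the car parked there.
  In \<open>park_car n occ c a\<close>, car \<open>c\<close> with preference \<open>a\<close> takes the first empty spot among
  \<open>a, \<dots>, n\<close>; if there is none, it fails to park and the configuration is unchanged.
\<close>

definition park_car :: "nat \<Rightarrow> (nat \<rightharpoonup> nat) \<Rightarrow> nat \<Rightarrow> nat \<Rightarrow> (nat \<rightharpoonup> nat)" where
  "park_car n occ c a =
     (let free = {s \<in> {a..n}. s \<notin> dom occ}
      in if free = {} then occ else occ(Min free \<mapsto> c))"

text \<open>\<open>park n \<alpha> k\<close> is the configuration after the arrivals of cars \<open>1, \<dots>, k\<close>, in this order.\<close>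

primrec park :: "nat \<Rightarrow> (nat \<Rightarrow> nat) \<Rightarrow> nat \<Rightarrow> (nat \<rightharpoonup> nat)" where
  "park n \<alpha> 0 = Map.empty"
| "park n \<alpha> (Suc k) = park_car n (park n \<alpha> k) (Suc k) (\<alpha> (Suc k))"

text \<open>Tuples in \<open>[n]\<^sup>n\<close> are extensional functions, so that distinct functions are distinct tuples.\<close>

definition parking_functions :: "nat \<Rightarrow> (nat \<Rightarrow> nat) set" where
  "parking_functions n =
     {\<alpha> \<in> {1..n} \<rightarrow>\<^sub>E {1..n}. ran (park n \<alpha> n) = {1..n}}"

text \<open>
  The map \<open>\<phi>\<close>. Its value is extended by the identity outside \<open>{1..n}\<close>, as required by
  \<^const>\<open>permutes\<close>.
\<close>

definition outcome :: "nat \<Rightarrow> (nat \<Rightarrow> nat) \<Rightarrow> (nat \<Rightarrow> nat)" where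
  "outcome n \<alpha> = (\<lambda>i. if i \<in> {1..n} then the (park n \<alpha> n i) else i)"

definition fiber :: "nat \<Rightarrow> (nat \<Rightarrow> nat) \<Rightarrow> (nat \<Rightarrow> nat) set" where
  "fiber n \<sigma> = {\<alpha> \<in> parking_functions n. outcome n \<alpha> = \<sigma>}"

definition fiber_count :: "nat \<Rightarrow> nat \<Rightarrow> nat" where
  "fiber_count n i = card {\<sigma>. \<sigma> permutes {1..n} \<and> card (fiber n \<sigma>) = i}"

text \<open>
  Finite formal sums of powers \<open>q\<^sup>r\<close> with real \<open>r\<close> form the monoid ring of \<open>(\<real>, +)\<close> over the
  integers: finitely supported maps from exponents to coefficients, multiplied by convolution.
\<close>

definition qpow :: "real \<Rightarrow> real \<Rightarrow>\<^sub>0 int" where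
  "qpow r = Poly_Mapping.single r 1"

definition log_gf :: "nat \<Rightarrow> real \<Rightarrow>\<^sub>0 int" where
  "log_gf n = (\<Sum>i = 1..fact n. of_nat (fiber_count n i) * qpow (ln (real i)))"

end

theory Submission
  imports Defs "HOL-Library.Infinite_Set" "HOL-Combinatorics.Multiset_Permutations"
begin

text \<open>
  Fix \<open>\<sigma> \<in> S\<^sub>n\<close>. A tuple has outcome \<open>\<sigma>\<close> iff every car \<open>\<sigma> i\<close> prefers a spot \<open>a \<le> i\<close> such that all
  of \<open>a, \<dots>, i\<close> finally hold cars numbered at most \<open>\<sigma> i\<close>. These conditions are independent, so the
  fiber of \<open>\<sigma>\<close> has as many elements as the product over \<open>i\<close> of the lengths of the longest blocks
  ending at \<open>i\<close> whose maximum is \<open>\<sigma> i\<close>. No such block of a smaller entry crosses the maximal entry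
  \<open>n\<close>, and if \<open>n\<close> has \<open>i\<close> entries to its left then its own block has length \<open>i + 1\<close>. Hence the product
  for \<open>\<sigma>\<close> is \<open>i + 1\<close> times the products for the words left and right of \<open>n\<close>. The product depends
  only on the relative order of the entries, and there are \<open>n - 1\<close> choose \<open>i\<close> ways to distribute
  the other values over the two sides.
\<close>

section \<open>Run weights of words\<close>

text \<open>
  Words are read from right to left, so the head of the list is the last entry of the permutation.
\<close>

fun run_weight :: "'a::linorder list \<Rightarrow> nat" where
  "run_weight [] = 1"
| "run_weight (x # xs) = (1 + length (takeWhile (\<lambda>y. y \<le> x) xs)) * run_weight xs"

lemma run_weight_pos: "run_weight xs > 0"
  by (induction xs) auto

text \<open>Each factor is at most the length of the word that remains. The bound keeps all fiber
  sizes within the summation range of \<open>log_gf\<close>.\<close>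

lemma run_weight_le_fact: "run_weight xs \<le> fact (length xs)"
proof (induction xs)
  case (Cons x xs)
  have "1 + length (takeWhile (\<lambda>y. y \<le> x) xs) \<le> Suc (length xs)"
    by (simp add: length_takeWhile_le)
  with Cons show ?case
    using mult_le_mono by (auto simp del: mult_Suc)
qed simp

text \<open>Only comparisons between entries enter the weight, so relabelling in increasing order
  does not change it.\<close>

lemma run_weight_map_strict_mono_on:
  assumes "strict_mono_on (set xs) f"
  shows "run_weight (map f xs) = run_weight xs"
  using assms
proof (induction xs)
  case (Cons x xs)
  have "takeWhile (\<lambda>y. f y \<le> f x) xs = takeWhile (\<lambda>y. y \<le> x) xs"
    using Cons.prems by (intro takeWhile_cong) (auto simp: strict_mono_on_leD strict_mono_on_less_eq)
  moreover have "strict_mono_on (set xs) f"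
    using Cons.prems by (rule monotone_on_subset) auto
  ultimately show ?case
    using Cons.IH by (simp add: takeWhile_map comp_def)
qed simp

text \<open>The run of \<open>m\<close> swallows all of \<open>zs\<close>, whereas every run that
  starts in \<open>ys\<close> stops before \<open>m\<close>; hence the factors separate.\<close>

lemma run_weight_append_Max:
  assumes "\<And>y. y \<in> set ys \<Longrightarrow> y < m" "\<And>z. z \<in> set zs \<Longrightarrow> z < m"
  shows "run_weight (ys @ m # zs) = Suc (length zs) * run_weight ys * run_weight zs"
  using assms(1)
proof (induction ys)
  case Nil
  have "takeWhile (\<lambda>z. z \<le> m) zs = zs"
    using assms(2) by (auto simp: takeWhile_eq_all_conv less_imp_le)
  then show ?case by (simp del: takeWhile_eq_all_conv)
next
  case (Cons y ys)
  have "takeWhile (\<lambda>z. z \<le> y) (ys @ m # zs) = takeWhile (\<lambda>z. z \<le> y) ys"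
    using Cons.prems[of y] by (induction ys) auto
  with Cons show ?case by (simp add: algebra_simps)
qed

section \<open>Generating functions of run weights\<close>

lemma qpow_ln_mult:
  assumes "a > 0" "b > 0"
  shows "qpow (ln (real (a * b))) = qpow (ln (real a)) * qpow (ln (real b))"
  using assms by (simp add: qpow_def mult_single ln_mult)

text \<open>Arbitrary label sets are allowed because splitting at the maximum leaves words over
  subsets that need not be intervals.\<close>

definition weight_gf :: "'a::linorder set \<Rightarrow> real \<Rightarrow>\<^sub>0 int" where
  "weight_gf S = (\<Sum>xs\<in>permutations_of_set S. qpow (ln (real (run_weight xs))))"

lemma weight_gf_image:
  assumes "strict_mono_on S f"
  shows "weight_gf (f ` S) = weight_gf S"
proof -
  have inj: "inj_on f S"
    using assms by (rule strict_mono_on_imp_inj_on)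
  have "inj_on (map f) (permutations_of_set S)"
    using inj by (intro inj_on_mapI) (auto simp: inj_on_def permutations_of_set_def)
  then show ?thesis
    using assms unfolding weight_gf_def permutations_of_set_image_inj[OF inj]
    by (subst sum.reindex)
      (auto intro!: sum.cong simp: run_weight_map_strict_mono_on permutations_of_set_def)
qed

lemma weight_gf_eq_card:
  fixes S :: "nat set"
  assumes "finite S"
  shows "weight_gf S = weight_gf {1..card S}"
proof -
  \<comment> \<open>Both sides are compared with \<open>{..<card T}\<close>, which every finite
    \<open>T\<close> matches by an increasing bijection.\<close>
  have *: "weight_gf T = weight_gf {..<card T}" if fin: "finite T" for T :: "nat set"
  proof -
    obtain h where "bij_betw h {..<card T} T" "strict_mono_on {..<card T} h"
      using ex_bij_betw_strict_mono_card[OF fin] by blast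
    then show ?thesis
      using weight_gf_image[of "{..<card T}" h] by (simp add: bij_betw_def)
  qed
  show ?thesis
    using *[OF assms] *[of "{1..card S}"] by simp
qed

text \<open>Each word is cut at \<open>m\<close>. \<open>A\<close> is the set of entries after
  \<open>m\<close> in the list, that is, to the left of \<open>m\<close> in the permutation, so the
  run of \<open>m\<close> has length \<open>card A + 1\<close>.\<close>

lemma weight_gf_insert_Max:
  assumes "finite S" "\<And>x. x \<in> S \<Longrightarrow> x < m"
  shows "weight_gf (insert m S) =
    (\<Sum>A\<in>Pow S. qpow (ln (real (card A + 1))) * weight_gf A * weight_gf (S - A))"
proof -
  let ?q = "\<lambda>xs :: 'a list. qpow (ln (real (run_weight xs)))"
  let ?D = "SIGMA A:Pow S. permutations_of_set A \<times> permutations_of_set (S - A)"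
  let ?f = "\<lambda>(A, zs, ys). ys @ m # zs"
  have inj: "inj_on ?f ?D"
  proof (rule inj_onI, clarsimp simp: permutations_of_set_def)
    fix ys zs ys' zs'
    assume "set ys = S - set zs" "set ys' = S - set zs'" "ys @ m # zs = ys' @ m # zs'"
      and "set zs \<subseteq> S" "set zs' \<subseteq> S"
    \<comment> \<open>Since \<open>m\<close> occurs in none of the four parts, the place of the cut
      is unique.\<close>
    moreover from this have "m \<notin> set ys" "m \<notin> set zs" "m \<notin> set ys'" "m \<notin> set zs'"
      using assms(2)[of m] by auto
    ultimately have "ys = ys' \<and> zs = zs'"
      by (auto simp: append_Cons_eq_iff)
    then show "set zs = set zs' \<and> zs = zs' \<and> ys = ys'" by simp
  qed
  have image: "?f ` ?D = permutations_of_set (insert m S)"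
  proof (intro equalityI subsetI)
    fix xs assume "xs \<in> ?f ` ?D"
    moreover have "m \<notin> S" using assms(2)[of m] by auto
    ultimately show "xs \<in> permutations_of_set (insert m S)"
      by (auto simp: permutations_of_set_def)
  next
    fix xs assume xs: "xs \<in> permutations_of_set (insert m S)"
    then have "m \<in> set xs" by (simp add: permutations_of_set_def)
    then obtain ys zs where split: "xs = ys @ m # zs"
      by (meson split_list)
    have "m \<notin> S" using assms(2)[of m] by auto
    with xs split have "set zs \<subseteq> S" "set ys = S - set zs" "distinct ys" "distinct zs"
      by (auto simp: permutations_of_set_def)
    with split show "xs \<in> ?f ` ?D"
      by (intro image_eqI[of _ _ "(set zs, zs, ys)"]) (auto simp: permutations_of_set_def)
  qed
  have q: "?q (ys @ m # zs) = qpow (ln (real (card A + 1))) * (?q zs * ?q ys)"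
    if "A \<subseteq> S" "zs \<in> permutations_of_set A" "ys \<in> permutations_of_set (S - A)" for A zs ys
  proof -
    have "run_weight (ys @ m # zs) = Suc (length zs) * run_weight ys * run_weight zs"
      using that assms(2) by (intro run_weight_append_Max) (auto simp: permutations_of_set_def)
    moreover have "length zs = card A"
      using that(2) by (simp add: length_finite_permutations_of_set)
    ultimately have "run_weight (ys @ m # zs) = (card A + 1) * (run_weight zs * run_weight ys)"
      by (simp add: algebra_simps)
    then show ?thesis
      by (simp only: qpow_ln_mult run_weight_pos nat_0_less_mult_iff add_gr_0 zero_less_one simp_thms)
  qed
  have fin: "\<forall>A\<in>Pow S. finite (permutations_of_set A \<times> permutations_of_set (S - A))"
    by simp
  have "weight_gf (insert m S) = (\<Sum>p\<in>?D. ?q (?f p))"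
    unfolding weight_gf_def image[symmetric] sum.reindex[OF inj] by (simp add: comp_def)
  also have "\<dots> = (\<Sum>A\<in>Pow S. \<Sum>p\<in>permutations_of_set A \<times> permutations_of_set (S - A). ?q (?f (A, p)))"
    using assms(1) fin by (subst sum.Sigma) (auto intro!: sum.cong)
  also have "\<dots> = (\<Sum>A\<in>Pow S. \<Sum>(zs, ys)\<in>permutations_of_set A \<times> permutations_of_set (S - A).
      qpow (ln (real (card A + 1))) * (?q zs * ?q ys))"
    by (intro sum.cong) (auto simp: q)
  also have "\<dots> = (\<Sum>A\<in>Pow S. qpow (ln (real (card A + 1))) * weight_gf A * weight_gf (S - A))"
  proof (rule sum.cong[OF refl])
    fix A
    have "weight_gf A * weight_gf (S - A) =
        (\<Sum>(zs, ys)\<in>permutations_of_set A \<times> permutations_of_set (S - A). ?q zs * ?q ys)"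
      by (simp add: weight_gf_def sum_product sum.cartesian_product)
    then show "(\<Sum>(zs, ys)\<in>permutations_of_set A \<times> permutations_of_set (S - A).
        qpow (ln (real (card A + 1))) * (?q zs * ?q ys)) =
      qpow (ln (real (card A + 1))) * weight_gf A * weight_gf (S - A)"
      by (simp add: mult.assoc sum_distrib_left case_prod_unfold)
  qed
  finally show ?thesis .
qed

section \<open>Fibers of the outcome map\<close>

text \<open>The final street of outcome \<open>\<sigma>\<close> with the cars after \<open>k\<close>
  removed: the only configuration at time \<open>k\<close> compatible with that outcome.\<close>

definition occupancy :: "nat \<Rightarrow> (nat \<Rightarrow> nat) \<Rightarrow> nat \<Rightarrow> nat \<rightharpoonup> nat" where
  "occupancy n \<sigma> k = (\<lambda>s. if s \<in> {1..n} \<and> \<sigma> s \<le> k then Some (\<sigma> s) else None)"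

text \<open>The index \<open>i\<close> is a spot, not a car: these are the choices that bring car
  \<open>\<sigma> i\<close> to spot \<open>i\<close>.\<close>

definition preferences :: "(nat \<Rightarrow> nat) \<Rightarrow> nat \<Rightarrow> nat set" where
  "preferences \<sigma> i = {a \<in> {1..i}. \<forall>j\<in>{a..i}. \<sigma> j \<le> \<sigma> i}"

lemma park_car_cases:
  obtains "park_car n occ c a = occ" "{s \<in> {a..n}. s \<notin> dom occ} = {}"
  | s where "park_car n occ c a = occ(s \<mapsto> c)" "s \<in> {a..n}" "s \<notin> dom occ" "{a..<s} \<subseteq> dom occ"
proof (cases "{s \<in> {a..n}. s \<notin> dom occ} = {}")
  case True
  then show ?thesis using that(1) by (simp add: park_car_def Let_def)
next
  case False
  define F where "F = {s \<in> {a..n}. s \<notin> dom occ}"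
  have F: "finite F" "F \<noteq> {}" using False by (simp_all add: F_def)
  have "{a..<Min F} \<subseteq> dom occ"
  proof
    fix s assume s: "s \<in> {a..<Min F}"
    moreover have "Min F \<le> n" using Min_in[OF F] by (simp add: F_def)
    ultimately show "s \<in> dom occ"
      using Min_le[OF F(1), of s] by (fastforce simp: F_def)
  qed
  moreover have "park_car n occ c a = occ(Min F \<mapsto> c)"
    using F(2) unfolding park_car_def F_def Let_def by (simp only: if_False)
  ultimately show ?thesis
    using Min_in[OF F] by (intro that(2)[of "Min F"]) (simp_all add: F_def)
qed

lemma park_SomeD:
  assumes "park n \<alpha> k s = Some c"
  shows "c \<le> k" "s \<le> n"
proof -
  have "c \<le> k \<and> s \<le> n"
    using assms
  proof (induction k)
    case (Suc k)
    show ?case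
      by (rule park_car_cases[of n "park n \<alpha> k" "Suc k" "\<alpha> (Suc k)"])
        (use Suc in \<open>auto split: if_splits\<close>)
  qed simp
  then show "c \<le> k" "s \<le> n" by auto
qed

text \<open>Parked cars never move, and later cars carry larger numbers. The street at any time can
  therefore be read off from a later one.\<close>

lemma park_eq_Some_iff:
  assumes "k \<le> m"
  shows "park n \<alpha> k s = Some c \<longleftrightarrow> park n \<alpha> m s = Some c \<and> c \<le> k"
  using assms
proof (induction m rule: dec_induct)
  case base
  then show ?case using park_SomeD by blast
next
  case (step m)
  show ?case
    by (rule park_car_cases[of n "park n \<alpha> m" "Suc m" "\<alpha> (Suc m)"])
      (use step in \<open>auto split: if_splits\<close>)
qed

lemma park_pos:
  assumes "park n \<alpha> k s = Some c" "\<And>i. i \<in> {1..k} \<Longrightarrow> \<alpha> i \<ge> 1"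
  shows "s \<ge> 1"
  using assms
proof (induction k)
  case (Suc k)
  have "\<alpha> (Suc k) \<ge> 1" by (rule Suc.prems(2)) simp
  moreover have "s \<ge> 1" if "park n \<alpha> k s = Some c"
    using that Suc.prems(2) by (intro Suc.IH) simp_all
  moreover note Suc.prems(1)
  ultimately show ?case
    by - (rule park_car_cases[of n "park n \<alpha> k" "Suc k" "\<alpha> (Suc k)"],
      auto split: if_splits)
qed simp

text \<open>Car \<open>Suc k\<close> reaches \<open>i\<close> exactly when \<open>i\<close> is the
  first free spot from \<open>a\<close> on, that is, when earlier cars fill all spots from
  \<open>a\<close> to just before \<open>i\<close>.\<close>

lemma park_car_occupancy_iff:
  assumes \<sigma>: "\<sigma> permutes {1..n}" and i: "i \<in> {1..n}" and \<sigma>i: "\<sigma> i = Suc k" and a: "a \<ge> 1"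
  shows "park_car n (occupancy n \<sigma> k) (Suc k) a = occupancy n \<sigma> (Suc k) \<longleftrightarrow> a \<in> preferences \<sigma> i"
proof -
  let ?occ = "occupancy n \<sigma> k"
  have inj: "\<sigma> s = \<sigma> t \<longleftrightarrow> s = t" for s t
    using permutes_inj[OF \<sigma>] by (simp add: inj_eq)
  have next_occ: "occupancy n \<sigma> (Suc k) = ?occ(i \<mapsto> Suc k)"
  proof
    fix s
    show "occupancy n \<sigma> (Suc k) s = (?occ(i \<mapsto> Suc k)) s"
      using inj[of s i] i \<sigma>i by (auto simp: occupancy_def le_Suc_eq)
  qed
  have dom: "s \<in> dom ?occ \<longleftrightarrow> s \<in> {1..n} \<and> \<sigma> s \<le> k" for s
    by (auto simp: occupancy_def split: if_splits)
  have i_free: "i \<notin> dom ?occ" using \<sigma>i dom by simp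
  \<comment> \<open>This separates a car that fails to park, leaving the street unchanged, from one
    that parks in \<open>i\<close>.\<close>
  then have ne: "?occ(i \<mapsto> Suc k) \<noteq> ?occ"
    by (metis domIff fun_upd_same option.distinct(1))
  \<comment> \<open>By injectivity \<open>i\<close> is the only spot with value
    \<open>Suc k\<close>, so the other spots of the block must hold cars numbered at most
    \<open>k\<close>.\<close>
  have pref: "a \<in> preferences \<sigma> i \<longleftrightarrow> a \<le> i \<and> {a..<i} \<subseteq> dom ?occ"
  proof -
    have "\<sigma> j \<le> \<sigma> i \<longleftrightarrow> j = i \<or> \<sigma> j \<le> k" for j
      using inj[of j i] \<sigma>i by (auto simp: le_Suc_eq)
    then show ?thesis
      using a i by (auto simp: preferences_def dom subset_iff Ball_def)
  qed
  show ?thesis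
  proof (rule park_car_cases[of n ?occ "Suc k" a])
    assume *: "park_car n ?occ (Suc k) a = ?occ" "{s \<in> {a..n}. s \<notin> dom ?occ} = {}"
    have "\<not> a \<le> i" using * i_free i by auto
    then show ?thesis using * ne next_occ pref by auto
  next
    fix s
    assume *: "park_car n ?occ (Suc k) a = ?occ(s \<mapsto> Suc k)" "s \<in> {a..n}" "s \<notin> dom ?occ"
      "{a..<s} \<subseteq> dom ?occ"
    have "?occ(s \<mapsto> Suc k) = ?occ(i \<mapsto> Suc k) \<longleftrightarrow> s = i"
      using i_free by (metis domIff fun_upd_other fun_upd_same option.distinct(1))
    moreover have "s = i \<longleftrightarrow> a \<le> i \<and> {a..<i} \<subseteq> dom ?occ"
    proof
      assume "a \<le> i \<and> {a..<i} \<subseteq> dom ?occ"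
      then have "\<not> s < i" "\<not> i < s"
        using * i_free by auto
      then show "s = i" by simp
    qed (use * in auto)
    ultimately show ?thesis using *(1) next_occ pref by simp
  qed
qed

text \<open>This trades a condition on the final street for one on every arrival, which can be
  checked car by car.\<close>

lemma fiber_iff_park_eq_occupancy:
  assumes \<sigma>: "\<sigma> permutes {1..n}" and \<alpha>: "\<alpha> \<in> {1..n} \<rightarrow>\<^sub>E {1..n}"
  shows "\<alpha> \<in> fiber n \<sigma> \<longleftrightarrow> (\<forall>k\<le>n. park n \<alpha> k = occupancy n \<sigma> k)"
proof
  have \<sigma>_le: "\<sigma> s \<le> n" if "s \<in> {1..n}" for s
    using permutes_in_image[OF \<sigma>, of s] that by simp
  {
    assume fib: "\<alpha> \<in> fiber n \<sigma>"
    have "dom (park n \<alpha> n) \<subseteq> {1..n}"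
    proof
      fix s assume "s \<in> dom (park n \<alpha> n)"
      then obtain c where c: "park n \<alpha> n s = Some c" by blast
      have "\<alpha> i \<ge> 1" if "i \<in> {1..n}" for i
        using \<alpha> that by (auto dest: PiE_mem)
      then show "s \<in> {1..n}"
        using park_pos[OF c] park_SomeD(2)[OF c] by simp
    qed
    \<comment> \<open>The \<open>n\<close> parked cars need \<open>n\<close> spots, so no spot stays
      empty. This matters because \<open>outcome\<close> applies \<open>the\<close>, which carries
      no information at an empty spot.\<close>
    moreover have "card (dom (park n \<alpha> n)) \<ge> n"
    proof -
      have "ran (park n \<alpha> n) = {1..n}"
        using fib by (simp add: fiber_def parking_functions_def)
      moreover have "ran (park n \<alpha> n) = (\<lambda>s. the (park n \<alpha> n s)) ` dom (park n \<alpha> n)"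
        by (force simp: ran_def dom_def image_def)
      ultimately show ?thesis
        using card_image_le[of "dom (park n \<alpha> n)" "\<lambda>s. the (park n \<alpha> n s)"]
          \<open>dom (park n \<alpha> n) \<subseteq> {1..n}\<close> by (simp add: finite_subset)
    qed
    ultimately have dom: "dom (park n \<alpha> n) = {1..n}"
      by (intro card_subset_eq) (auto intro: antisym dest: card_mono[rotated])
    have final: "park n \<alpha> n s = Some c \<longleftrightarrow> s \<in> {1..n} \<and> c = \<sigma> s" for s c
    proof -
      have "outcome n \<alpha> s = \<sigma> s" using fib by (simp add: fiber_def)
      moreover have "s \<in> {1..n} \<longleftrightarrow> park n \<alpha> n s \<noteq> None"
        using dom by blast
      ultimately show ?thesis by (auto simp: outcome_def)
    qed
    show "\<forall>k\<le>n. park n \<alpha> k = occupancy n \<sigma> k"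
    proof (intro allI impI ext)
      fix k s assume "k \<le> n"
      then have "park n \<alpha> k s = Some c \<longleftrightarrow> occupancy n \<sigma> k s = Some c" for c
        using park_eq_Some_iff[of k n n \<alpha> s c] final by (auto simp: occupancy_def)
      then show "park n \<alpha> k s = occupancy n \<sigma> k s"
        by (metis not_None_eq)
    qed
  }
  {
    assume "\<forall>k\<le>n. park n \<alpha> k = occupancy n \<sigma> k"
    then have final: "park n \<alpha> n s = (if s \<in> {1..n} then Some (\<sigma> s) else None)" for s
      using \<sigma>_le by (auto simp: occupancy_def)
    then have "ran (park n \<alpha> n) = \<sigma> ` {1..n}"
      by (auto simp: ran_def image_iff)
    then have "ran (park n \<alpha> n) = {1..n}"
      using permutes_image[OF \<sigma>] by simp
    moreover have "outcome n \<alpha> = \<sigma>"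
      using final permutes_not_in[OF \<sigma>] by (auto simp: outcome_def)
    ultimately show "\<alpha> \<in> fiber n \<sigma>"
      using \<alpha> by (simp add: fiber_def parking_functions_def)
  }
qed

text \<open>As long as the earlier cars have followed \<open>\<sigma>\<close>, the street before
  each arrival depends on \<open>\<sigma>\<close> alone. The conditions on the cars are thus
  independent; \<open>inv \<sigma> c\<close> is the spot meant for car \<open>c\<close>.\<close>

lemma fiber_eq_PiE:
  assumes \<sigma>: "\<sigma> permutes {1..n}"
  shows "fiber n \<sigma> = (\<Pi>\<^sub>E c\<in>{1..n}. preferences \<sigma> (inv \<sigma> c))"
proof -
  have inv_in: "inv \<sigma> c \<in> {1..n}" if "c \<in> {1..n}" for c
    using permutes_in_image[OF permutes_inv[OF \<sigma>], of c] that by simp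
  have "(\<forall>k\<le>n. park n \<alpha> k = occupancy n \<sigma> k) \<longleftrightarrow> (\<forall>c\<in>{1..n}. \<alpha> c \<in> preferences \<sigma> (inv \<sigma> c))"
    if \<alpha>: "\<alpha> \<in> {1..n} \<rightarrow>\<^sub>E {1..n}" for \<alpha>
  proof -
    have step: "park_car n (occupancy n \<sigma> k) (Suc k) (\<alpha> (Suc k)) = occupancy n \<sigma> (Suc k) \<longleftrightarrow>
      \<alpha> (Suc k) \<in> preferences \<sigma> (inv \<sigma> (Suc k))" if "k < n" for k
      using that \<alpha> inv_in[of "Suc k"] permutes_inverses(1)[OF \<sigma>]
      by (intro park_car_occupancy_iff[OF \<sigma>]) (auto dest: PiE_mem)
    have "(\<forall>k\<le>n. park n \<alpha> k = occupancy n \<sigma> k) \<longleftrightarrow>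
      (\<forall>k<n. \<alpha> (Suc k) \<in> preferences \<sigma> (inv \<sigma> (Suc k)))"
    proof (intro iffI allI impI)
      fix k
      assume "\<forall>k\<le>n. park n \<alpha> k = occupancy n \<sigma> k" "k < n"
      then show "\<alpha> (Suc k) \<in> preferences \<sigma> (inv \<sigma> (Suc k))"
        using step[of k] by (metis Suc_leI less_imp_le park.simps(2))
    next
      fix k
      assume pref: "\<forall>k<n. \<alpha> (Suc k) \<in> preferences \<sigma> (inv \<sigma> (Suc k))" and "k \<le> n"
      from \<open>k \<le> n\<close> show "park n \<alpha> k = occupancy n \<sigma> k"
      proof (induction k)
        case 0
        \<comment> \<open>Cars are numbered from 1, so \<open>occupancy n \<sigma> 0\<close> is the
          empty street.\<close>
        have "\<sigma> s \<noteq> 0" if "s \<in> {1..n}" for s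
          using permutes_in_image[OF \<sigma>, of s] that by simp
        then show ?case by (auto simp: occupancy_def)
      next
        case (Suc k)
        then show ?case using pref step[of k] by simp
      qed
    qed
    also have "\<dots> \<longleftrightarrow> (\<forall>c\<in>Suc ` {..<n}. \<alpha> c \<in> preferences \<sigma> (inv \<sigma> c))"
      by blast
    finally show ?thesis by (simp only: image_Suc_lessThan)
  qed
  note iff = this
  have "preferences \<sigma> (inv \<sigma> c) \<subseteq> {1..n}" if "c \<in> {1..n}" for c
    using inv_in[OF that] by (auto simp: preferences_def)
  then have PiE_subset: "(\<Pi>\<^sub>E c\<in>{1..n}. preferences \<sigma> (inv \<sigma> c)) \<subseteq> {1..n} \<rightarrow>\<^sub>E {1..n}"
    by (intro PiE_mono)
  have fiber_subset: "fiber n \<sigma> \<subseteq> {1..n} \<rightarrow>\<^sub>E {1..n}"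
    by (auto simp only: fiber_def parking_functions_def)
  show ?thesis
  proof (rule set_eqI)
    fix \<alpha>
    show "\<alpha> \<in> fiber n \<sigma> \<longleftrightarrow> \<alpha> \<in> (\<Pi>\<^sub>E c\<in>{1..n}. preferences \<sigma> (inv \<sigma> c))"
    proof (cases "\<alpha> \<in> {1..n} \<rightarrow>\<^sub>E {1..n}")
      case True
      then have "\<alpha> \<in> extensional {1..n}" by (simp only: PiE_iff)
      then show ?thesis
        by (simp only: PiE_iff fiber_iff_park_eq_occupancy[OF \<sigma> True] iff[OF True] simp_thms)
    next
      case False
      then show ?thesis using PiE_subset fiber_subset by blast
    qed
  qed
qed

section \<open>Fiber sizes as run weights\<close>

lemma card_suffix_eq_length_takeWhile:
  "card {a \<in> {1..i}. \<forall>j\<in>{a..i}. P j} = length (takeWhile P (rev [1..<Suc i]))"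
proof (induction i)
  case (Suc i)
  \<comment> \<open>Every block ending at \<open>Suc i\<close> contains \<open>Suc i\<close>: if
    \<open>P\<close> fails there, none qualifies; otherwise the one-element block is new and the
    others extend blocks ending at \<open>i\<close>.\<close>
  have "{a \<in> {1..Suc i}. \<forall>j\<in>{a..Suc i}. P j} =
    (if P (Suc i) then insert (Suc i) {a \<in> {1..i}. \<forall>j\<in>{a..i}. P j} else {})"
    by (auto simp: le_Suc_eq)
  with Suc show ?case by simp
qed simp

lemma card_fiber:
  assumes \<sigma>: "\<sigma> permutes {1..n}"
  shows "card (fiber n \<sigma>) = run_weight (map \<sigma> (rev [1..<Suc n]))"
proof -
  \<comment> \<open>The summand 1 counts spot \<open>Suc i\<close> itself as a preference.\<close>
  have card_pref: "card (preferences \<sigma> (Suc i)) =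
    1 + length (takeWhile (\<lambda>y. y \<le> \<sigma> (Suc i)) (map \<sigma> (rev [1..<Suc i])))" for i
    unfolding preferences_def card_suffix_eq_length_takeWhile
    by (simp add: takeWhile_map comp_def)
  have "card (fiber n \<sigma>) = (\<Prod>c\<in>{1..n}. card (preferences \<sigma> (inv \<sigma> c)))"
    by (simp add: fiber_eq_PiE[OF \<sigma>] card_PiE)
  \<comment> \<open>Reindexing along \<open>inv \<sigma>\<close> passes from cars to spots.\<close>
  also have "\<dots> = (\<Prod>i\<in>{1..n}. card (preferences \<sigma> i))"
    using prod.permute[OF permutes_inv[OF \<sigma>], of "\<lambda>i. card (preferences \<sigma> i)"]
    by (simp add: comp_def)
  also have "\<dots> = run_weight (map \<sigma> (rev [1..<Suc n]))"
    by (induction n) (simp_all add: card_pref mult.commute)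
  finally show ?thesis .
qed

lemma bij_betw_permutes_permutations_of_set:
  "bij_betw (\<lambda>\<sigma>. map \<sigma> (rev [1..<Suc n])) {\<sigma>. \<sigma> permutes {1..n}} (permutations_of_set {1..n})"
proof -
  let ?f = "\<lambda>\<sigma> :: nat \<Rightarrow> nat. map \<sigma> (rev [1..<Suc n])"
  let ?P = "{\<sigma>. \<sigma> permutes {1..n}}"
  have set: "set [1..<Suc n] = {1..n}" by auto
  have inj: "inj_on ?f ?P"
  proof (rule inj_onI)
    fix \<sigma> \<tau> assume "\<sigma> \<in> ?P" "\<tau> \<in> ?P" and eq: "?f \<sigma> = ?f \<tau>"
    have "\<sigma> i = \<tau> i" for i
    proof (cases "i \<in> {1..n}")
      case True
      with eq set show ?thesis by (simp only: map_eq_conv set_rev)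
    next
      case False
      with \<open>\<sigma> \<in> ?P\<close> \<open>\<tau> \<in> ?P\<close> show ?thesis by (metis mem_Collect_eq permutes_not_in)
    qed
    then show "\<sigma> = \<tau>" by blast
  qed
  have "?f ` ?P \<subseteq> permutations_of_set {1..n}"
  proof clarify
    fix \<sigma> assume \<sigma>: "\<sigma> permutes {1..n}"
    have "set (?f \<sigma>) = {1..n}"
      using permutes_image[OF \<sigma>] set by (simp only: set_map set_rev)
    moreover have "distinct (?f \<sigma>)"
      using permutes_inj_on[OF \<sigma>] by (simp only: distinct_map distinct_rev distinct_upt simp_thms)
    ultimately show "?f \<sigma> \<in> permutations_of_set {1..n}"
      by (simp only: permutations_of_set_def mem_Collect_eq simp_thms)
  qed
  \<comment> \<open>Surjectivity follows by counting: both sets have \<open>n!\<close>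
    elements.\<close>
  moreover have "card (?f ` ?P) = card (permutations_of_set {1..n})"
    by (simp only: card_image[OF inj] card_permutations[OF refl] card_permutations_of_set finite_atLeastAtMost)
  ultimately have "?f ` ?P = permutations_of_set {1..n}"
    by (intro card_subset_eq) simp_all
  with inj show ?thesis by (simp only: bij_betw_def simp_thms)
qed

section \<open>The recurrence\<close>

lemma log_gf_eq_weight_gf: "log_gf n = weight_gf {1..n}"
proof -
  let ?P = "{\<sigma>. \<sigma> permutes {1..n}}"
  have fin: "finite ?P" by (simp add: finite_permutations)
  \<comment> \<open>No fiber is empty and none exceeds \<open>n!\<close>, so grouping the
    permutations by fiber size over this range misses none.\<close>
  have card_in: "(\<lambda>\<sigma>. card (fiber n \<sigma>)) ` ?P \<subseteq> {1..fact n}"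
  proof clarify
    fix \<sigma> assume "\<sigma> permutes {1..n}"
    then show "card (fiber n \<sigma>) \<in> {1..fact n}"
      using run_weight_pos run_weight_le_fact[of "map \<sigma> (rev [1..<Suc n])"]
      by (simp add: card_fiber Suc_le_eq del: upt_Suc)
  qed
  have "log_gf n = (\<Sum>i = 1..fact n. \<Sum>\<sigma>\<in>{\<sigma> \<in> ?P. card (fiber n \<sigma>) = i}.
      qpow (ln (real (card (fiber n \<sigma>)))))"
    by (simp add: log_gf_def fiber_count_def)
  also have "\<dots> = (\<Sum>\<sigma>\<in>?P. qpow (ln (real (card (fiber n \<sigma>)))))"
    using fin card_in by (intro sum.group) simp_all
  also have "\<dots> = (\<Sum>\<sigma>\<in>?P. qpow (ln (real (run_weight (map \<sigma> (rev [1..<Suc n]))))))"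
    by (intro sum.cong) (simp_all only: card_fiber mem_Collect_eq)
  also have "\<dots> = weight_gf {1..n}"
    unfolding weight_gf_def
    by (rule sum.reindex_bij_betw[OF bij_betw_permutes_permutations_of_set])
  finally show ?thesis .
qed

lemma sum_Pow_card:
  fixes g :: "nat \<Rightarrow> 'b::comm_semiring_1"
  assumes "finite S"
  shows "(\<Sum>A\<in>Pow S. g (card A)) = (\<Sum>i = 0..card S. of_nat (card S choose i) * g i)"
proof -
  have "(\<Sum>A\<in>Pow S. g (card A)) = (\<Sum>i = 0..card S. \<Sum>A\<in>{A \<in> Pow S. card A = i}. g (card A))"
    using assms by (intro sum.group[symmetric]) (auto intro: card_mono)
  also have "\<dots> = (\<Sum>i = 0..card S. of_nat (card S choose i) * g i)"
    using n_subsets[OF assms] by (simp add: Pow_def)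
  finally show ?thesis .
qed

theorem proposition4p2:
  fixes n :: nat
  assumes "n \<ge> 1"
  shows "log_gf n =
    (\<Sum>i = 0..n - 1. of_nat ((n - 1) choose i) * qpow (ln (real (i + 1)))
                       * log_gf i * log_gf (n - 1 - i))"
proof -
  let ?S = "{1..n - 1}"
  have "log_gf n = weight_gf (insert n ?S)"
  proof -
    have "{1..n} = insert n ?S" using assms by auto
    then show ?thesis by (simp only: log_gf_eq_weight_gf)
  qed
  \<comment> \<open>Here \<open>A\<close> collects the cars parked to the left of car
    \<open>n\<close>.\<close>
  also have "\<dots> = (\<Sum>A\<in>Pow ?S. qpow (ln (real (card A + 1))) * weight_gf A * weight_gf (?S - A))"
    using assms by (intro weight_gf_insert_Max) auto
  \<comment> \<open>Each summand now depends only on \<open>card A\<close>, so grouping the subsets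
    by size produces the binomial coefficients.\<close>
  also have "\<dots> = (\<Sum>A\<in>Pow ?S. qpow (ln (real (card A + 1))) * log_gf (card A) * log_gf (n - 1 - card A))"
  proof (intro sum.cong refl)
    fix A assume "A \<in> Pow ?S"
    then have "finite A" "card (?S - A) = n - 1 - card A"
      by (auto simp: card_Diff_subset finite_subset)
    then show "qpow (ln (real (card A + 1))) * weight_gf A * weight_gf (?S - A) =
      qpow (ln (real (card A + 1))) * log_gf (card A) * log_gf (n - 1 - card A)"
      by (simp only: weight_gf_eq_card[of A] weight_gf_eq_card[of "?S - A"] log_gf_eq_weight_gf
          finite_Diff finite_atLeastAtMost)
  qed
  also have "\<dots> = (\<Sum>i = 0..n - 1. of_nat ((n - 1) choose i) *
      (qpow (ln (real (i + 1))) * log_gf i * log_gf (n - 1 - i)))"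
    using sum_Pow_card[of ?S "\<lambda>i. qpow (ln (real (i + 1))) * log_gf i * log_gf (n - 1 - i)"]
    by simp
  finally show ?thesis
    by (simp only: mult.assoc)
qed

end
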